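(* If a compact space $K$ has the $^*$extension property, then every twisted sum of $c_0$ and $C(K)$ is trivial.
   Context: Compact spaces are Hausdorff. For compact $K$, $C(K)$ is the Banach space of continuous real-valued functions on $K$, and $C(K)^*$ is identified with the space $M(K)$ of signed Radon measures on $K$ of finite variation. $M_1(K)$ is the closed unit ball of $M(K)$ with the weak$^*$ topology; write $\nu(g)=\int g\,d\nu$. A compact space $L'\supseteq L$ is a countable discrete extension of a compact space $L$ if $L'\setminus L$ is countable and discrete. A compact space $K$ has the $^*$extension property if for every countable discrete extension $L'$ of $M_1(K)$ there is a bounded linear operator $E:C(K)\to C(L')$ such that $Eg(\nu)=\nu(g)$ for all $g\in C(K)$ and $\nu\in M_1(K)$. A twisted sum of Banach spaces $Z$ and $Y$ is a short exact sequence $0\to Z\to X\to Y\to 0$ with $X$ a Banach space and the maps bounded linear operators; it is trivial if it splits, i.e. the map $Z\to X$ has a bounded linear left inverse (equivalently, the range of $Z\to X$ is complemented in $X$). *)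

theory Defs
  imports "HOL-Analysis.Analysis"
begin

section \<open>The Banach spaces \<open>C(K)\<close> and \<open>c\<^sub>0\<close>\<close>

text \<open>
  A compact space \<open>K\<close> is a type of class \<^class>\<open>t2_space\<close> with compact \<^const>\<open>UNIV\<close>. All continuous
  functions on it are bounded, so \<open>C(K)\<close> with the supremum norm is \<open>'k \<Rightarrow>\<^sub>C real\<close>. The library
  shows completeness of this type only for metric domains.
\<close>

instance bcontfun :: (topological_space, complete_space) complete_space
proof
  fix f :: "nat \<Rightarrow> ('a, 'b) bcontfun"
  assume "Cauchy f"
  then obtain g where "uniform_limit UNIV f g sequentially"
    using uniformly_convergent_eq_cauchy[of "\<lambda>_. True" f]
    unfolding Cauchy_def uniform_limit_sequentially_iff
    by (metis dist_fun_lt_imp_dist_val_lt)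
  then show "convergent f"
    by (metis uniform_limit_bcontfunE sequentially_bot convergentI)
qed

instance bcontfun :: (topological_space, banach) banach ..

lemma continuous_imp_bcontfun:
  fixes f :: "'k::topological_space \<Rightarrow> 'b::metric_space"
  assumes "compact (UNIV :: 'k set)" "continuous_on UNIV f"
  shows "f \<in> bcontfun"
  using assms by (auto simp: bcontfun_def intro: compact_imp_bounded compact_continuous_image)

text \<open>The topology of \<^typ>\<open>nat\<close> is discrete, so \<open>nat \<Rightarrow>\<^sub>C real\<close> is the space of bounded sequences.\<close>

typedef c0 = "{f :: nat \<Rightarrow>\<^sub>C real. apply_bcontfun f \<longlonglongrightarrow> 0}"
  by (rule exI[of _ 0]) simp

setup_lifting type_definition_c0

instantiation c0 :: real_normed_vector
begin

lift_definition zero_c0 :: c0 is 0 by simp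
lift_definition plus_c0 :: "c0 \<Rightarrow> c0 \<Rightarrow> c0" is "(+)"
  using tendsto_add_zero by fastforce
lift_definition minus_c0 :: "c0 \<Rightarrow> c0 \<Rightarrow> c0" is "(-)"
  using tendsto_diff[where a = 0 and b = 0] by fastforce
lift_definition uminus_c0 :: "c0 \<Rightarrow> c0" is uminus
  using tendsto_minus[where a = 0] by fastforce
lift_definition scaleR_c0 :: "real \<Rightarrow> c0 \<Rightarrow> c0" is scaleR
  using tendsto_mult_right_zero by fastforce
lift_definition norm_c0 :: "c0 \<Rightarrow> real" is norm .
lift_definition dist_c0 :: "c0 \<Rightarrow> c0 \<Rightarrow> real" is dist .
lift_definition sgn_c0 :: "c0 \<Rightarrow> c0" is sgn
  using tendsto_mult_right_zero by (fastforce simp: sgn_div_norm divide_inverse)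

definition uniformity_c0 :: "(c0 \<times> c0) filter"
  where "uniformity_c0 = (INF e\<in>{0 <..}. principal {(x, y). dist x y < e})"

definition open_c0 :: "c0 set \<Rightarrow> bool"
  where "open_c0 S = (\<forall>x\<in>S. \<forall>\<^sub>F (x', y) in uniformity. x' = x \<longrightarrow> y \<in> S)"

instance
proof
  fix a b :: real and x y z :: c0
  show "x + y + z = x + (y + z)" by transfer (rule add.assoc)
  show "x + y = y + x" by transfer (rule add.commute)
  show "0 + x = x" by transfer simp
  show "- x + x = 0" by transfer simp
  show "x - y = x + - y" by transfer simp
  show "a *\<^sub>R (x + y) = a *\<^sub>R x + a *\<^sub>R y" by transfer (rule scaleR_add_right)
  show "(a + b) *\<^sub>R x = a *\<^sub>R x + b *\<^sub>R x" by transfer (rule scaleR_add_left)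
  show "a *\<^sub>R b *\<^sub>R x = (a * b) *\<^sub>R x" by transfer simp
  show "1 *\<^sub>R x = x" by transfer simp
  show "dist x y = norm (x - y)" by transfer (rule dist_norm)
  show "sgn x = inverse (norm x) *\<^sub>R x" by transfer (rule sgn_div_norm)
  show "norm x = 0 \<longleftrightarrow> x = 0" by transfer simp
  show "norm (x + y) \<le> norm x + norm y" by transfer (rule norm_triangle_ineq)
  show "norm (a *\<^sub>R x) = \<bar>a\<bar> * norm x" by transfer simp
qed (rule uniformity_c0_def open_c0_def)+

end

instance c0 :: banach
proof
  fix X :: "nat \<Rightarrow> c0"
  assume "Cauchy X"
  then have "Cauchy (\<lambda>n. Rep_c0 (X n))"
    by (simp add: Cauchy_def dist_c0.rep_eq)
  then obtain l where l: "(\<lambda>n. Rep_c0 (X n)) \<longlonglongrightarrow> l"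
    using Cauchy_convergent convergent_def by blast
  have "apply_bcontfun l \<longlonglongrightarrow> 0"
  proof (rule swap_uniform_limit'[where g = "\<lambda>_. 0"])
    show "\<forall>\<^sub>F n in sequentially. (apply_bcontfun (Rep_c0 (X n)) \<longlongrightarrow> 0) sequentially"
      using Rep_c0 by auto
    show "uniform_limit UNIV (\<lambda>n. apply_bcontfun (Rep_c0 (X n))) (apply_bcontfun l) sequentially"
      using l by (rule tendsto_bcontfun_uniform_limit)
  qed simp_all
  then have "Rep_c0 (Abs_c0 l) = l"
    by (simp add: Abs_c0_inverse)
  then have "X \<longlonglongrightarrow> Abs_c0 l"
    using l by (simp add: tendsto_iff dist_c0.rep_eq)
  then show "convergent X"
    by (rule convergentI)
qed

section \<open>Twisted sums\<close>

definition twisted_sum :: "('z::banach \<Rightarrow> 'x::banach) \<Rightarrow> ('x \<Rightarrow> 'y::banach) \<Rightarrow> bool" where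
  "twisted_sum j q \<longleftrightarrow>
     bounded_linear j \<and> bounded_linear q \<and> inj j \<and> range j = {x. q x = 0} \<and> surj q"

definition trivial_twisted_sum :: "('z::banach \<Rightarrow> 'x::banach) \<Rightarrow> ('x \<Rightarrow> 'y::banach) \<Rightarrow> bool" where
  "trivial_twisted_sum j q \<longleftrightarrow>
     twisted_sum j q \<and> (\<exists>p :: 'x \<Rightarrow> 'z. bounded_linear p \<and> (\<forall>z. p (j z) = z))"

section \<open>Countable discrete extensions\<close>

text \<open>
  The inclusion of \<open>L\<close> in \<open>L'\<close> is an embedding \<open>e\<close>, since the points of \<open>L'\<close> outside \<open>L\<close> may
  have to live in another type. As usual, countable includes finite.
\<close>

definition countable_discrete_extension ::
    "'a topology \<Rightarrow> 'b topology \<Rightarrow> ('a \<Rightarrow> 'b) \<Rightarrow> bool" where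
  "countable_discrete_extension L L' e \<longleftrightarrow>
     compact_space L' \<and> Hausdorff_space L' \<and> embedding_map L L' e \<and>
     countable (topspace L' - e ` topspace L) \<and>
     subtopology L' (topspace L' - e ` topspace L) = discrete_topology (topspace L' - e ` topspace L)"

text \<open>
  A bounded linear operator from \<open>X\<close> to \<open>C(L)\<close>, for a compact space \<open>L\<close> given as a value of type
  \<^typ>\<open>'b topology\<close>. Elements of \<open>C(L)\<close> are functions on the whole type that only matter on
  \<^term>\<open>topspace L\<close>; the last conjunct bounds the operator for the supremum norm over \<open>topspace L\<close>.
\<close>

definition bounded_linear_to_C :: "'b topology \<Rightarrow> ('x::real_normed_vector \<Rightarrow> 'b \<Rightarrow> real) \<Rightarrow> bool" where
  "bounded_linear_to_C L E \<longleftrightarrow>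
     (\<forall>g. continuous_map L euclideanreal (E g)) \<and>
     (\<forall>g h. \<forall>y\<in>topspace L. E (g + h) y = E g y + E h y) \<and>
     (\<forall>c g. \<forall>y\<in>topspace L. E (c *\<^sub>R g) y = c * E g y) \<and>
     (\<exists>B. \<forall>g. \<forall>y\<in>topspace L. \<bar>E g y\<bar> \<le> B * norm g)"

section \<open>The extension property\<close>

text \<open>
  \<open>M(K)\<close> is identified with the dual of \<open>C(K)\<close>: a signed Radon measure \<open>\<nu>\<close> is the functional
  \<open>g \<mapsto> \<integral>g d\<nu>\<close>, and its variation is the functional norm.
\<close>

type_synonym 'k radon_measures = "('k \<Rightarrow>\<^sub>C real) \<Rightarrow>\<^sub>L real"

text \<open>
  On functionals, \<^const>\<open>strong_operator_topology\<close> (pointwise convergence) is the weak* topology.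
\<close>

definition M1 :: "'k::topological_space radon_measures topology" where
  "M1 = subtopology strong_operator_topology (cball 0 1)"

text \<open>
  Quantification over all extensions \<open>L'\<close> has to be bounded by a type. Since only countably many
  points are added to \<open>M\<^sub>1(K)\<close>, the sum with \<^typ>\<open>nat\<close> has room for every extension up to
  homeomorphism; the lemma below removes the restriction.
\<close>

definition star_extension_property :: "'k::t2_space itself \<Rightarrow> bool" where
  "star_extension_property (_ :: 'k itself) \<longleftrightarrow>
     (\<forall>(L' :: ('k radon_measures + nat) topology) e.
        countable_discrete_extension M1 L' e \<longrightarrow>
        (\<exists>E :: ('k \<Rightarrow>\<^sub>C real) \<Rightarrow> 'k radon_measures + nat \<Rightarrow> real.
           bounded_linear_to_C L' E \<and>
           (\<forall>g. \<forall>\<nu>\<in>cball 0 1. E g (e \<nu>) = blinfun_apply \<nu> g)))"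

lemma topspace_M1 [simp]: "topspace M1 = cball 0 1"
  by (simp add: M1_def strong_operator_topology_topspace)

lemma countable_discrete_extension_homeomorphic:
  assumes ext: "countable_discrete_extension L L' e"
    and hom: "homeomorphic_map L' L'' f"
  shows "countable_discrete_extension L L'' (f \<circ> e)"
proof -
  have emb: "embedding_map L L' e" and cd: "compact_space L'" "Hausdorff_space L'"
    and cnt: "countable (topspace L' - e ` topspace L)"
    and disc: "subtopology L' (topspace L' - e ` topspace L)
                 = discrete_topology (topspace L' - e ` topspace L)"
    using ext by (auto simp: countable_discrete_extension_def)
  have surj: "f ` topspace L' = topspace L''" and inj: "inj_on f (topspace L')"
    using hom by (auto simp: homeomorphic_eq_everything_map)
  have "e ` topspace L = topspace (subtopology L' (e ` topspace L))"
    using emb homeomorphic_imp_surjective_map unfolding embedding_map_def by blast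
  then have sub: "e ` topspace L \<subseteq> topspace L'"
    unfolding topspace_subtopology by blast
  define S where "S = topspace L' - e ` topspace L"
  define T where "T = topspace L'' - (f \<circ> e) ` topspace L"
  have T: "f ` S = T"
    using inj_on_image_set_diff[OF inj Diff_subset sub] surj unfolding S_def T_def by (simp add: image_comp)
  have S_sub: "S \<subseteq> topspace L'" and T_sub: "T \<subseteq> topspace L''"
    by (auto simp: S_def T_def)
  have "f ` (topspace L' \<inter> S) = topspace L'' \<inter> T"
    using T S_sub T_sub by (simp add: Int_absorb1)
  then have hST: "homeomorphic_map (subtopology L' S) (subtopology L'' T) f"
    by (rule homeomorphic_map_subtopologies[OF hom])
  have "openin (subtopology L'' T) {y}" if y: "y \<in> T" for y
  proof -
    obtain x where x: "x \<in> S" "y = f x"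
      using y T by blast
    then show ?thesis
      using homeomorphic_map_openness[OF hST, of "{x}"] S_sub disc unfolding S_def[symmetric] by auto
  qed
  then have "subtopology L'' T = discrete_topology T"
    using discrete_topology_unique_alt[of T "subtopology L'' T"] by simp
  moreover have "embedding_map L L'' (f \<circ> e)"
    using emb hom embedding_map_compose surjective_embedding_map by blast
  moreover have "countable T"
    using cnt T unfolding S_def by (metis countable_image)
  moreover have "compact_space L''" "Hausdorff_space L''"
    using cd homeomorphic_compact_space homeomorphic_Hausdorff_space
      homeomorphic_map_imp_homeomorphic_space[OF hom] by blast+
  ultimately show ?thesis
    unfolding countable_discrete_extension_def T_def by blast
qed

lemma star_extension_property_arbitrary_type:
  fixes L' :: "'b topology" and e :: "'k::t2_space radon_measures \<Rightarrow> 'b"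
  assumes star: "star_extension_property TYPE('k)"
    and ext: "countable_discrete_extension M1 L' e"
  shows "\<exists>E :: ('k \<Rightarrow>\<^sub>C real) \<Rightarrow> 'b \<Rightarrow> real. bounded_linear_to_C L' E \<and>
           (\<forall>g. \<forall>\<nu>\<in>cball 0 1. E g (e \<nu>) = blinfun_apply \<nu> g)"
proof -
  define L :: "'k radon_measures topology" where "L = M1"
  define D where "D = topspace L' - e ` topspace L"
  define f :: "'b \<Rightarrow> 'k radon_measures + nat" where
    "f y = (if y \<in> D then Inr (to_nat_on D y) else Inl (inv_into (topspace L) e y))" for y
  have "countable D"
    using ext by (simp add: countable_discrete_extension_def D_def L_def)
  then have inj: "inj_on f (topspace L')"
    by (auto simp: inj_on_def f_def D_def dest: inj_on_to_nat_on inv_into_injective)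
  define h where "h = inv_into (topspace L') f"
  define L'' where "L'' = pullback_topology (f ` topspace L') h L'"
  have hf: "h (f y) = y" if "y \<in> topspace L'" for y
    using that inj by (simp add: h_def)
  have top: "topspace L'' = f ` topspace L'"
    using hf by (auto simp: L''_def topspace_pullback_topology)
  have "continuous_map L'' L' (id \<circ> h)"
    unfolding L''_def by (rule continuous_map_pullback) (rule continuous_map_id)
  moreover have "continuous_map L' L' (h \<circ> f)"
    by (rule continuous_map_eq[OF continuous_map_id]) (simp add: hf)
  then have "continuous_map L' L'' f"
    unfolding L''_def by (rule continuous_map_pullback') auto
  ultimately have "homeomorphic_maps L' L'' f h"
    using hf top by (auto simp: homeomorphic_maps_def)
  then have hom: "homeomorphic_map L' L'' f"
    using homeomorphic_map_maps by blast
  obtain E :: "('k \<Rightarrow>\<^sub>C real) \<Rightarrow> 'k radon_measures + nat \<Rightarrow> real" where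
    E: "bounded_linear_to_C L'' E" "\<And>g \<nu>. \<nu> \<in> cball 0 1 \<Longrightarrow> E g ((f \<circ> e) \<nu>) = blinfun_apply \<nu> g"
    using star countable_discrete_extension_homeomorphic[OF ext hom]
    unfolding star_extension_property_def by blast
  have "bounded_linear_to_C L' (\<lambda>g. E g \<circ> f)"
    using E(1) \<open>continuous_map L' L'' f\<close> continuous_map_compose[of L' L'' f euclideanreal]
    by (auto simp: bounded_linear_to_C_def top)
  with E(2) show ?thesis
    by (intro exI[of _ "\<lambda>g. E g \<circ> f"]) auto
qed

end

theory Submission
  imports Defs
begin

text \<open>
  Let \<open>0 \<rightarrow> c\<^sub>0 \<rightarrow> X \<rightarrow> C(K) \<rightarrow> 0\<close> be the sequence given by \<open>j\<close> and \<open>q\<close>. A left inverse of \<open>j\<close> is the same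
  as a sequence of functionals on \<open>X\<close> that extend the coordinates \<open>j z \<mapsto> z n\<close>, are uniformly
  bounded, and tend to \<open>0\<close> at each point of \<open>X\<close> (\<open>bounded_linear_c0_of\<close>). Since \<open>j\<close> is bounded
  below, the Hahn--Banach theorem gives bounded extensions \<open>f n\<close>; what they may lack is
  convergence to \<open>0\<close>. The only freedom left is to subtract functionals that vanish on the range of
  \<open>j\<close>, that is, functionals \<open>\<mu> n \<circ> q\<close> with \<open>\<mu> n\<close> in \<open>M(K)\<close>. So a bounded sequence \<open>\<mu> n\<close> is needed
  with \<open>f n x - \<mu> n (q x) \<longlonglongrightarrow> 0\<close> for every \<open>x\<close>.

  The extension property supplies it. The map \<open>\<nu> \<mapsto> \<nu> \<circ> q\<close> embeds \<open>M\<^sub>1(K)\<close> into the functionals on \<open>X\<close>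
  with pointwise convergence. A cluster point of \<open>f n\<close> vanishes on the range of \<open>j\<close>, because the
  coordinates of an element of \<open>c\<^sub>0\<close> tend to \<open>0\<close>; hence it is a measure composed with \<open>q\<close>, and after
  multiplying all \<open>f n\<close> by a small constant \<open>a\<close> it lies in the copy of \<open>M\<^sub>1(K)\<close>. The norm control
  uses that every \<open>g\<close> in \<open>C(K)\<close> has a preimage under \<open>q\<close> of norm at most a constant times the norm
  of \<open>g\<close> (\<open>closed_range_bounded_lift\<close>, the open mapping theorem). So the copy of \<open>M\<^sub>1(K)\<close> together
  with the points \<open>P n = a f n\<close> is compact (\<open>closed_Un_biorthogonal\<close>), and each \<open>P n\<close> is isolated in
  it, being the only point with a nonzero value at \<open>j\<close> of the \<open>n\<close>th unit vector
  (\<open>biorthogonal_isolated\<close>). This is a countable discrete extension of \<open>M\<^sub>1(K)\<close>.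

  Let \<open>E\<close> be an extension operator for it. For fixed \<open>x\<close> the function
  \<open>\<phi> \<mapsto> \<phi> x - E (q x) \<phi>\<close> is continuous and vanishes on the copy of \<open>M\<^sub>1(K)\<close>, so by compactness it tends
  to \<open>0\<close> along the isolated points (\<open>tendsto_zero_along_isolated_points\<close>). Hence
  \<open>\<mu> n g = E g (P n) / a\<close> is the required sequence.
\<close>

section \<open>Dominated extension of linear functionals\<close>

definition sublinear :: "('a::real_vector \<Rightarrow> real) \<Rightarrow> bool" where
  "sublinear p \<longleftrightarrow> (\<forall>x y. p (x + y) \<le> p x + p y) \<and> (\<forall>c>0. \<forall>x. p (c *\<^sub>R x) \<le> c * p x)"

lemma sublinearI:
  assumes "\<And>x y. p (x + y) \<le> p x + p y" and "\<And>c x. 0 < c \<Longrightarrow> p (c *\<^sub>R x) \<le> c * p x"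
  shows "sublinear p"
  using assms by (simp add: sublinear_def)

lemma sublinear_add: "sublinear p \<Longrightarrow> p (x + y) \<le> p x + p y"
  by (simp add: sublinear_def)

lemma sublinear_scaleR_le: "sublinear p \<Longrightarrow> 0 < c \<Longrightarrow> p (c *\<^sub>R x) \<le> c * p x"
  by (simp add: sublinear_def)

lemma sublinear_zero:
  assumes "sublinear p"
  shows "p 0 = 0"
  using sublinear_scaleR_le[OF assms, of 2 0] sublinear_scaleR_le[OF assms, of "1/2" 0] by simp

lemma sublinear_scaleR:
  assumes "sublinear p" "0 \<le> c"
  shows "p (c *\<^sub>R x) = c * p x"
proof (cases "c = 0")
  case True
  then show ?thesis by (simp add: sublinear_zero[OF assms(1)])
next
  case False
  then have c: "0 < c" using assms(2) by simp
  then have "p x \<le> inverse c * p (c *\<^sub>R x)"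
    using sublinear_scaleR_le[OF assms(1), of "inverse c" "c *\<^sub>R x"] by simp
  then have "c * p x \<le> p (c *\<^sub>R x)"
    using c by (simp add: field_simps)
  then show ?thesis
    using sublinear_scaleR_le[OF assms(1) c, of x] by simp
qed

lemma sublinear_minus_le: "sublinear p \<Longrightarrow> - p (- x) \<le> p x"
  using sublinear_add[of p x "- x"] sublinear_zero[of p] by simp

lemma sublinear_diff_le: "sublinear p \<Longrightarrow> p x - p y \<le> p (x - y)"
  using sublinear_add[of p "x - y" y] by simp

text \<open>
  Given two members of the chain, the smaller one is below both, so a sum of two values of different
  members is bounded below by a value of a single member; this makes the infimum subadditive.
\<close>

lemma sublinear_INF_chain:
  assumes ne: "C \<noteq> {}"
    and sub: "\<And>p. p \<in> C \<Longrightarrow> sublinear p"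
    and chain: "\<And>p p'. p \<in> C \<Longrightarrow> p' \<in> C \<Longrightarrow> p \<le> p' \<or> p' \<le> p"
    and bdd: "\<And>x. bdd_below ((\<lambda>p. p x) ` C)"
  shows "sublinear (\<lambda>x. INF p\<in>C. p x)"
proof (rule sublinearI)
  fix x y
  have "(INF p\<in>C. p (x + y)) - p1 x \<le> p2 y" if p12: "p1 \<in> C" "p2 \<in> C" for p1 p2
  proof -
    obtain p where p: "p \<in> C" "p \<le> p1" "p \<le> p2"
      using chain[OF p12] p12 by blast
    have "(INF p\<in>C. p (x + y)) \<le> p (x + y)"
      using p(1) bdd by (rule cINF_lower[rotated])
    also have "\<dots> \<le> p x + p y"
      using p(1) sub sublinear_add by blast
    also have "\<dots> \<le> p1 x + p2 y"
      using p by (intro add_mono) (auto simp: le_fun_def)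
    finally show ?thesis by simp
  qed
  then have "(INF p\<in>C. p (x + y)) - p1 x \<le> (INF p\<in>C. p y)" if "p1 \<in> C" for p1
    using that by (intro cINF_greatest ne) auto
  then have "(INF p\<in>C. p (x + y)) - (INF p\<in>C. p y) \<le> (INF p\<in>C. p x)"
    by (intro cINF_greatest ne) (simp add: algebra_simps)
  then show "(INF p\<in>C. p (x + y)) \<le> (INF p\<in>C. p x) + (INF p\<in>C. p y)"
    by simp
next
  fix c :: real and x
  assume c: "0 < c"
  have "(INF p\<in>C. p (c *\<^sub>R x)) / c \<le> p x" if "p \<in> C" for p
  proof -
    have "(INF p\<in>C. p (c *\<^sub>R x)) \<le> p (c *\<^sub>R x)"
      using that bdd by (rule cINF_lower[rotated])
    also have "\<dots> \<le> c * p x"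
      using that sub c sublinear_scaleR_le by blast
    finally show ?thesis using c by (simp add: field_simps)
  qed
  then have "(INF p\<in>C. p (c *\<^sub>R x)) / c \<le> (INF p\<in>C. p x)"
    by (intro cINF_greatest ne)
  then show "(INF p\<in>C. p (c *\<^sub>R x)) \<le> c * (INF p\<in>C. p x)"
    using c by (simp add: field_simps)
qed

lemma minimal_sublinear_exists:
  assumes p: "sublinear p"
  shows "\<exists>m. sublinear m \<and> m \<le> p \<and> (\<forall>m'. sublinear m' \<longrightarrow> m' \<le> m \<longrightarrow> m' = m)"
proof -
  let ?A = "{f. sublinear f \<and> f \<le> p}"
  have "\<exists>m\<in>?A. \<forall>a\<in>?A. a \<le> m \<longrightarrow> a = m"
  proof (rule predicate_Zorn)
    show "partial_order_on ?A (relation_of (\<lambda>x y. y \<le> x) ?A)"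
      by (rule partial_order_on_relation_ofI) auto
  next
    fix C
    assume C: "C \<in> Chains (relation_of (\<lambda>x y. y \<le> x) ?A)"
    then have C_A: "C \<subseteq> ?A" and C_chain: "\<And>f g. f \<in> C \<Longrightarrow> g \<in> C \<Longrightarrow> f \<le> g \<or> g \<le> f"
      by (auto simp: Chains_def relation_of_def)
    show "\<exists>u\<in>?A. \<forall>a\<in>C. u \<le> a"
    proof (cases "C = {}")
      case True
      then show ?thesis using p by auto
    next
      case False
      have bdd: "bdd_below ((\<lambda>f. f x) ` C)" for x
      proof (rule bdd_belowI2)
        fix f assume f: "f \<in> C"
        then have "f (- x) \<le> p (- x)" "- f (- x) \<le> f x"
          using C_A sublinear_minus_le by (auto simp: le_fun_def)
        then show "- p (- x) \<le> f x" by linarith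
      qed
      let ?u = "\<lambda>x. INF f\<in>C. f x"
      have u: "?u \<le> f" if "f \<in> C" for f
        using that bdd by (auto simp: le_fun_def intro: cINF_lower)
      have "sublinear ?u"
        using C_A C_chain by (intro sublinear_INF_chain False bdd) auto
      moreover have "?u \<le> p"
        using False u C_A order_trans[of ?u _ p] by blast
      ultimately show ?thesis using u by blast
    qed
  qed
  then show ?thesis
    using order_trans by blast
qed

text \<open>
  For a direction \<open>y\<close>, the infimum over \<open>t \<ge> 0\<close> of \<open>m (x + t y) - t m y\<close> is again sublinear in \<open>x\<close> and
  lies below \<open>m\<close> (take \<open>t = 0\<close>). Minimality makes it equal to \<open>m\<close>, and then \<open>t = 1\<close> gives
  \<open>m x + m y \<le> m (x + y)\<close>, the converse of subadditivity.
\<close>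

lemma minimal_sublinear_linear:
  assumes m: "sublinear m"
    and min: "\<And>m'. sublinear m' \<Longrightarrow> m' \<le> m \<Longrightarrow> m' = m"
  shows "linear m"
proof -
  have add: "m (x + y) = m x + m y" for x y
  proof -
    let ?T = "{0::real..}"
    define k where "k x t = m (x + t *\<^sub>R y) - t * m y" for x t
    have low: "- m (- x) \<le> k x t" if "t \<in> ?T" for x t
      using sublinear_diff_le[OF m, of "t *\<^sub>R y" "- x"] sublinear_scaleR[OF m, of t y] that
      by (simp add: k_def add.commute)
    then have bdd: "bdd_below (k x ` ?T)" for x
      by (rule bdd_belowI2)
    have le: "(INF t\<in>?T. k x t) \<le> k x t" if "t \<in> ?T" for x t
      using that bdd by (rule cINF_lower[rotated])
    have "sublinear (\<lambda>x. INF t\<in>?T. k x t)"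
    proof (rule sublinearI)
      fix a b
      have *: "(INF t\<in>?T. k (a + b) t) - k a s \<le> k b t" if "s \<in> ?T" "t \<in> ?T" for s t
      proof -
        have "k (a + b) (s + t) \<le> k a s + k b t"
          using sublinear_add[OF m, of "a + s *\<^sub>R y" "b + t *\<^sub>R y"]
          by (simp add: k_def algebra_simps)
        then show ?thesis
          using le[of "s + t" "a + b"] that by simp
      qed
      have "(INF t\<in>?T. k (a + b) t) - k a s \<le> (INF t\<in>?T. k b t)" if "s \<in> ?T" for s
        using that by (intro cINF_greatest *) auto
      then have "(INF t\<in>?T. k (a + b) t) - (INF t\<in>?T. k b t) \<le> (INF t\<in>?T. k a t)"
        by (intro cINF_greatest) (auto simp: algebra_simps)
      then show "(INF t\<in>?T. k (a + b) t) \<le> (INF t\<in>?T. k a t) + (INF t\<in>?T. k b t)"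
        by simp
    next
      fix c :: real and a
      assume c: "0 < c"
      have "(INF t\<in>?T. k (c *\<^sub>R a) t) / c \<le> k a t" if "t \<in> ?T" for t
      proof -
        have "k (c *\<^sub>R a) (c * t) = c * k a t"
          using sublinear_scaleR[OF m, of c "a + t *\<^sub>R y"] c by (simp add: k_def algebra_simps)
        then show ?thesis
          using le[of "c * t" "c *\<^sub>R a"] that c by (simp add: field_simps)
      qed
      then have "(INF t\<in>?T. k (c *\<^sub>R a) t) / c \<le> (INF t\<in>?T. k a t)"
        by (intro cINF_greatest) auto
      then show "(INF t\<in>?T. k (c *\<^sub>R a) t) \<le> c * (INF t\<in>?T. k a t)"
        using c by (simp add: field_simps)
    qed
    moreover have "(\<lambda>x. INF t\<in>?T. k x t) \<le> m"
      using le[of 0] by (auto simp: le_fun_def k_def)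
    ultimately have "(\<lambda>x. INF t\<in>?T. k x t) = m"
      by (rule min)
    then have "m x \<le> k x 1"
      using le[of 1 x] by (metis atLeast_iff zero_le_one)
    then show ?thesis
      using sublinear_add[OF m, of x y] by (simp add: k_def)
  qed
  have neg: "m (- x) = - m x" for x
    using add[of x "- x"] sublinear_zero[OF m] by simp
  show ?thesis
  proof (rule linearI)
    show "m (x + y) = m x + m y" for x y
      by (rule add)
    fix c x
    show "m (c *\<^sub>R x) = c *\<^sub>R m x"
      using sublinear_scaleR[OF m, of c x] sublinear_scaleR[OF m, of "- c" x] neg[of "c *\<^sub>R x"]
      by (cases "0 \<le> c") auto
  qed
qed

text \<open>
  The Hahn--Banach theorem, with the subspace given as the range of a linear map \<open>j\<close> and the functional
  on it pulled back to the domain of \<open>j\<close>. The infimum over \<open>z\<close> of \<open>N (x - j z) + h z\<close> is sublinear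
  in \<open>x\<close>, and it is at most \<open>N x\<close>, and at most \<open>h z\<close> at \<open>x = j z\<close>. A minimal sublinear functional
  below it is linear, and a linear functional with \<open>f (j z) \<le> h z\<close> for all \<open>z\<close> satisfies
  equality, as one sees by replacing \<open>z\<close> by \<open>- z\<close>.
\<close>

theorem hahn_banach_along_linear_map:
  fixes j :: "'z::real_vector \<Rightarrow> 'x::real_vector"
  assumes N: "sublinear N" and j: "linear j" and h: "linear h" and dom: "\<And>z. h z \<le> N (j z)"
  shows "\<exists>f. linear f \<and> (\<forall>x. f x \<le> N x) \<and> (\<forall>z. f (j z) = h z)"
proof -
  define k where "k x z = N (x - j z) + h z" for x z
  have "- N (- x) \<le> k x z" for x z
  proof -
    have "N (- j z) - N (- x) \<le> N (x - j z)"
      using sublinear_diff_le[OF N, of "- j z" "- x"] by simp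
    moreover have "- h z \<le> N (- j z)"
      using dom[of "- z"] by (simp add: linear_neg[OF h] linear_neg[OF j])
    ultimately show ?thesis by (simp add: k_def)
  qed
  then have bdd: "bdd_below (range (k x))" for x
    by (rule bdd_belowI2)
  have le: "(INF z. k x z) \<le> k x z" for x z
    using bdd by (rule cINF_lower) simp
  have "sublinear (\<lambda>x. INF z. k x z)"
  proof (rule sublinearI)
    fix a b
    have *: "(INF z. k (a + b) z) - k a v \<le> k b w" for v w
    proof -
      have "k (a + b) (v + w) \<le> k a v + k b w"
        using sublinear_add[OF N, of "a - j v" "b - j w"]
        by (simp add: k_def linear_add[OF j] linear_add[OF h] algebra_simps)
      then show ?thesis using le[of "a + b" "v + w"] by simp
    qed
    have "(INF z. k (a + b) z) - k a v \<le> (INF z. k b z)" for v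
      by (intro cINF_greatest *) auto
    then have "(INF z. k (a + b) z) - (INF z. k b z) \<le> (INF z. k a z)"
      by (intro cINF_greatest) (auto simp: algebra_simps)
    then show "(INF z. k (a + b) z) \<le> (INF z. k a z) + (INF z. k b z)" by simp
  next
    fix c :: real and a
    assume c: "0 < c"
    have "(INF z. k (c *\<^sub>R a) z) / c \<le> k a z" for z
    proof -
      have "k (c *\<^sub>R a) (c *\<^sub>R z) = c * k a z"
        using sublinear_scaleR[OF N, of c "a - j z"] c
        by (simp add: k_def linear_scale[OF j] linear_scale[OF h] algebra_simps)
      then show ?thesis using le[of "c *\<^sub>R a" "c *\<^sub>R z"] c by (simp add: field_simps)
    qed
    then have "(INF z. k (c *\<^sub>R a) z) / c \<le> (INF z. k a z)"
      by (intro cINF_greatest) auto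
    then show "(INF z. k (c *\<^sub>R a) z) \<le> c * (INF z. k a z)"
      using c by (simp add: field_simps)
  qed
  then obtain f where f: "sublinear f" "f \<le> (\<lambda>x. INF z. k x z)"
      "\<And>m'. sublinear m' \<Longrightarrow> m' \<le> f \<Longrightarrow> m' = f"
    using minimal_sublinear_exists by blast
  have lin: "linear f"
    using f(1,3) by (rule minimal_sublinear_linear)
  have fk: "f x \<le> k x z" for x z
    using f(2) le[of x z] by (auto simp: le_fun_def intro: order_trans)
  have "f x \<le> N x" for x
    using fk[of x 0] by (simp add: k_def linear_0[OF j] linear_0[OF h])
  moreover have "f (j z) = h z" for z
    using fk[of "j z" z] fk[of "j (- z)" "- z"]
    by (simp add: k_def sublinear_zero[OF N] linear_neg[OF j] linear_neg[OF h] linear_neg[OF lin])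
  ultimately show ?thesis using lin by blast
qed

section \<open>Bounded lifts along operators with closed range\<close>

text \<open>
  The range is a complete metric space, covered by the closures of the images of the balls of radius
  \<open>n\<close>. By Baire's theorem one of these closures contains a ball of the range, of radius \<open>e\<close> about some
  \<open>y0\<close>. A multiple \<open>c y\<close> of norm \<open>e / 2\<close> is the difference of \<open>y0 + c y\<close> and \<open>y0\<close>, both of which are
  approximated by images of vectors of norm at most \<open>n\<close>.
\<close>

lemma closed_range_approximate_lift:
  fixes T :: "'a::banach \<Rightarrow> 'b::banach"
  assumes T: "bounded_linear T" and cl: "closed (range T)"
  shows "\<exists>K>0. \<forall>y\<in>range T. \<exists>x. norm x \<le> K * norm y \<and> norm (y - T x) \<le> norm y / 2"
proof -
  interpret bounded_linear T by (rule T)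
  let ?Y = "top_of_set (range T)"
  define G where "G n = range T \<inter> closure (T ` cball 0 (real n))" for n
  have Un: "\<Union> (range G) = range T"
  proof
    show "range T \<subseteq> \<Union> (range G)"
    proof clarsimp
      fix x :: 'a
      obtain n where "norm x \<le> real n" using real_arch_simple by blast
      then have "T x \<in> G n"
        using closure_subset by (fastforce simp: G_def)
      then show "\<exists>n. T x \<in> G n" ..
    qed
  qed (auto simp: G_def)
  have "\<exists>n. ?Y interior_of G n \<noteq> {}"
  proof (rule ccontr)
    assume "\<not> ?thesis"
    then have emp: "?Y interior_of G n = {}" for n by blast
    have "closedin ?Y (G n)" for n
      unfolding G_def by (simp add: closedin_closed_Int)
    moreover have "completely_metrizable_space ?Y"
      using cl completely_metrizable_space_closedin completely_metrizable_space_euclidean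
      by (metis closed_closedin)
    ultimately have "?Y interior_of \<Union> (range G) = {}"
      using emp by (intro Baire_category_alt) auto
    then show False
      using Un interior_of_topspace[of ?Y] by (metis empty_iff range_eqI topspace_euclidean_subtopology)
  qed
  then obtain n y0 where "y0 \<in> ?Y interior_of G n" by blast
  then obtain U where "openin ?Y U" "U \<subseteq> G n" "y0 \<in> U"
    by (auto simp: interior_of_def)
  then obtain e where e: "0 < e" "ball y0 e \<inter> range T \<subseteq> G n" and y0: "y0 \<in> range T"
    unfolding openin_contains_ball by blast
  \<comment> \<open>\<open>n + 1\<close> keeps \<open>K\<close> positive when \<open>n = 0\<close>.\<close>
  define K where "K = 4 * (real n + 1) / e"
  show ?thesis
  proof (intro exI[of _ K] conjI ballI)
    show "0 < K" using e(1) by (simp add: K_def)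
    fix y assume y: "y \<in> range T"
    show "\<exists>x. norm x \<le> K * norm y \<and> norm (y - T x) \<le> norm y / 2"
    proof (cases "y = 0")
      case True
      then show ?thesis by (intro exI[of _ 0]) simp
    next
      case False
      define c where "c = e / (2 * norm y)"
      have c: "0 < c" "c * norm y = e / 2" using False e(1) by (auto simp: c_def)
      have mem: "y0 + c *\<^sub>R y \<in> range T"
      proof -
        obtain a b where "y0 = T a" "y = T b" using y y0 by blast
        then have "y0 + c *\<^sub>R y = T (a + c *\<^sub>R b)" by (simp add: add scaleR)
        then show ?thesis by blast
      qed
      have "y0 + c *\<^sub>R y \<in> ball y0 e" using c e(1) by (simp add: dist_norm)
      with mem e have "y0 + c *\<^sub>R y \<in> closure (T ` cball 0 n)" by (auto simp: G_def)
      then obtain u where u: "norm u \<le> n" "dist (T u) (y0 + c *\<^sub>R y) < e / 8"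
        using e(1) unfolding closure_approachable by (force dest: spec[of _ "e / 8"])
      have "y0 \<in> closure (T ` cball 0 n)"
        using e y0 by (auto simp: G_def)
      then obtain v where v: "norm v \<le> n" "dist (T v) y0 < e / 8"
        using e(1) unfolding closure_approachable by (force dest: spec[of _ "e / 8"])
      define x where "x = inverse c *\<^sub>R (u - v)"
      have "norm (u - v) \<le> 2 * (real n + 1)"
        using norm_triangle_ineq4[of u v] u(1) v(1) by simp
      then have "norm x \<le> inverse c * (2 * (real n + 1))"
        using c(1) by (simp add: x_def)
      also have "\<dots> = K * norm y"
        using False e(1) by (simp add: c_def K_def field_simps)
      finally have 1: "norm x \<le> K * norm y" .
      have "y - T x = inverse c *\<^sub>R ((y0 + c *\<^sub>R y - T u) - (y0 - T v))"
        using c(1) by (simp add: x_def scaleR diff algebra_simps)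
      moreover have "norm ((y0 + c *\<^sub>R y - T u) - (y0 - T v)) \<le> e / 8 + e / 8"
        using u(2) v(2) norm_triangle_ineq4[of "y0 + c *\<^sub>R y - T u" "y0 - T v"]
        by (simp add: dist_norm norm_minus_commute)
      ultimately have "norm (y - T x) \<le> inverse c * (e / 4)"
        using c(1) by simp
      also have "\<dots> = norm y / 2"
        using False e(1) by (simp add: c_def field_simps)
      finally show ?thesis using 1 by blast
    qed
  qed
qed

text \<open>
  The open mapping theorem, for operators onto a closed subspace. The approximate lift is iterated: the
  error halves at each step, so the corrections form an absolutely convergent series.
\<close>

theorem closed_range_bounded_lift:
  fixes T :: "'a::banach \<Rightarrow> 'b::banach"
  assumes T: "bounded_linear T" and cl: "closed (range T)"
  shows "\<exists>C>0. \<forall>y\<in>range T. \<exists>x. T x = y \<and> norm x \<le> C * norm y"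
proof -
  interpret bounded_linear T by (rule T)
  obtain K s where K: "0 < K"
    and s: "\<And>y. y \<in> range T \<Longrightarrow> norm (s y) \<le> K * norm y \<and> norm (y - T (s y)) \<le> norm y / 2"
    using closed_range_approximate_lift[OF T cl] by metis
  show ?thesis
  proof (intro exI[of _ "2 * K"] conjI ballI)
    show "0 < 2 * K" using K by simp
    fix y assume y: "y \<in> range T"
    define r where "r n = ((\<lambda>y. y - T (s y)) ^^ n) y" for n
    have r_Suc: "r (Suc n) = r n - T (s (r n))" for n by (simp add: r_def)
    have r: "r n \<in> range T \<and> norm (r n) \<le> norm y * (1/2) ^ n" for n
    proof (induction n)
      case 0
      then show ?case using y by (simp add: r_def)
    next
      case (Suc n)
      then obtain a where a: "r n = T a" by blast
      have "r (Suc n) = T (a - s (r n))" by (simp add: r_Suc diff flip: a)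
      moreover have "norm (r (Suc n)) \<le> norm (r n) / 2"
        using s[of "r n"] Suc by (simp add: r_Suc)
      ultimately show ?case using Suc by auto
    qed
    have bound: "norm (s (r n)) \<le> K * norm y * (1/2) ^ n" for n
    proof -
      have "norm (s (r n)) \<le> K * norm (r n)" using s r by blast
      also have "\<dots> \<le> K * (norm y * (1/2) ^ n)" using r K by (intro mult_left_mono) auto
      finally show ?thesis by simp
    qed
    have geo: "(\<lambda>n. K * norm y * (1/2::real) ^ n) sums (2 * K * norm y)"
      using sums_mult[OF geometric_sums[of "1/2::real"], of "K * norm y"] by (simp add: ac_simps)
    have summ: "summable (\<lambda>n. norm (s (r n)))"
      using bound by (intro summable_comparison_test'[OF sums_summable[OF geo]]) auto
    define x where "x = (\<Sum>n. s (r n))"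
    have "norm x \<le> (\<Sum>n. norm (s (r n)))"
      unfolding x_def by (rule summable_norm[OF summ])
    also have "\<dots> \<le> 2 * K * norm y"
      using suminf_le[OF bound summ sums_summable[OF geo]] sums_unique[OF geo] by simp
    finally have nx: "norm x \<le> 2 * K * norm y" .
    have part: "(\<Sum>i<n. T (s (r i))) = y - r n" for n
      by (induction n) (auto simp: r_Suc, simp add: r_def)
    have "(\<lambda>n. T (s (r n))) sums T x"
      unfolding x_def by (intro sums summable_sums summable_norm_cancel[OF summ])
    moreover have "(\<lambda>n. T (s (r n))) sums (y - 0)"
      unfolding sums_def part
    proof (intro tendsto_diff tendsto_const)
      have "(\<lambda>n. norm y * (1/2) ^ n) \<longlonglongrightarrow> norm y * 0"
        by (intro tendsto_intros LIMSEQ_power_zero) simp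
      then show "r \<longlonglongrightarrow> 0"
        using r by (intro Lim_null_comparison[of r "\<lambda>n. norm y * (1/2) ^ n"]) auto
    qed
    ultimately have "T x = y" using sums_unique2 by fastforce
    with nx show "\<exists>x. T x = y \<and> norm x \<le> 2 * K * norm y" by auto
  qed
qed

section \<open>Coordinates on \<open>c\<^sub>0\<close>\<close>

definition c0_nth :: "c0 \<Rightarrow> nat \<Rightarrow> real" where
  "c0_nth z = apply_bcontfun (Rep_c0 z)"

text \<open>Meaningful only when \<open>s\<close> tends to \<open>0\<close>.\<close>

definition c0_of :: "(nat \<Rightarrow> real) \<Rightarrow> c0" where
  "c0_of s = Abs_c0 (Bcontfun s)"

lemma c0_nth_tendsto: "c0_nth z \<longlonglongrightarrow> 0"
  using Rep_c0 by (simp add: c0_nth_def)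

lemma c0_nth_eqI: "(\<And>n. c0_nth z n = c0_nth w n) \<Longrightarrow> z = w"
  unfolding c0_nth_def by (metis Rep_c0_inject bcontfun_eqI)

lemma linear_c0_nth: "linear (\<lambda>z. c0_nth z n)"
  by (rule linearI) (simp_all add: c0_nth_def plus_c0.rep_eq scaleR_c0.rep_eq)

lemma abs_c0_nth_le: "\<bar>c0_nth z n\<bar> \<le> norm z"
  using norm_bounded[of "Rep_c0 z" n] by (simp add: c0_nth_def norm_c0.rep_eq)

lemma norm_c0_le: "(\<And>n. \<bar>c0_nth z n\<bar> \<le> B) \<Longrightarrow> norm z \<le> B"
  unfolding norm_c0.rep_eq by (rule norm_bound) (simp add: c0_nth_def)

lemma c0_nth_of [simp]:
  assumes "s \<longlonglongrightarrow> 0"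
  shows "c0_nth (c0_of s) = s"
proof -
  have "Bseq s" using assms by (rule convergent_imp_Bseq[OF convergentI])
  then have "s \<in> bcontfun"
    by (auto simp: bcontfun_def Bseq_eq_bounded)
  then have B: "apply_bcontfun (Bcontfun s) = s" by (rule Bcontfun_inverse)
  then have "Rep_c0 (c0_of s) = Bcontfun s"
    unfolding c0_of_def using assms by (intro Abs_c0_inverse) simp
  then show ?thesis by (simp add: c0_nth_def B)
qed

text \<open>
  An operator into \<open>c\<^sub>0\<close> amounts to a uniformly bounded sequence of functionals that converges to \<open>0\<close>
  pointwise.
\<close>

lemma bounded_linear_c0_of:
  fixes g :: "nat \<Rightarrow> 'x::real_normed_vector \<Rightarrow> real"
  assumes lin: "\<And>n. linear (g n)" and bound: "\<And>n x. \<bar>g n x\<bar> \<le> B * norm x"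
    and null: "\<And>x. (\<lambda>n. g n x) \<longlonglongrightarrow> 0"
  shows "bounded_linear (\<lambda>x. c0_of (\<lambda>n. g n x))"
proof (rule bounded_linear_intro)
  fix x y c
  show "c0_of (\<lambda>n. g n (x + y)) = c0_of (\<lambda>n. g n x) + c0_of (\<lambda>n. g n y)"
    by (rule c0_nth_eqI) (simp only: c0_nth_of[OF null] linear_add[OF linear_c0_nth], simp only: linear_add[OF lin])
  show "c0_of (\<lambda>n. g n (c *\<^sub>R x)) = c *\<^sub>R c0_of (\<lambda>n. g n x)"
    by (rule c0_nth_eqI) (simp only: c0_nth_of[OF null] linear_scale[OF linear_c0_nth], simp only: linear_scale[OF lin])
  show "norm (c0_of (\<lambda>n. g n x)) \<le> norm x * B"
    by (rule norm_c0_le) (simp add: null bound mult.commute)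
qed


section \<open>Functionals under pointwise convergence\<close>

text \<open>
  When \<open>q\<close> is onto, this is the set of functionals \<open>\<nu> \<circ> q\<close> with \<open>\<nu>\<close> in the dual unit ball, see
  \<open>quotient_ball_eq_pullback\<close>. Described by inequalities at the points of \<open>X\<close>, it is visibly closed under
  pointwise convergence.
\<close>

definition quotient_ball :: "('x::real_vector \<Rightarrow> 'y::real_normed_vector) \<Rightarrow> ('x \<Rightarrow> real) set" where
  "quotient_ball q = {\<phi>. linear \<phi> \<and> (\<forall>x. \<bar>\<phi> x\<bar> \<le> norm (q x))}"

lemma closed_dominated_functionals:
  fixes N :: "'x::real_vector \<Rightarrow> real"
  shows "closed {\<phi>. linear \<phi> \<and> (\<forall>x. \<bar>\<phi> x\<bar> \<le> N x)}"
proof -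
  have "{\<phi>. linear \<phi> \<and> (\<forall>x. \<bar>\<phi> x\<bar> \<le> N x)} =
      (\<Inter>x. \<Inter>y. {\<phi>. \<phi> (x + y) = \<phi> x + \<phi> y}) \<inter> (\<Inter>c. \<Inter>x. {\<phi>. \<phi> (c *\<^sub>R x) = c * \<phi> x})
        \<inter> (\<Inter>x. {\<phi>. \<bar>\<phi> x\<bar> \<le> N x})"
    by (auto simp: linear_iff)
  moreover have "closed \<dots>"
    by (intro closed_Int closed_INT ballI closed_Collect_eq closed_Collect_le continuous_intros
        continuous_on_product_coordinates)
  ultimately show ?thesis by simp
qed

text \<open>Tychonoff's theorem for a product of intervals.\<close>

lemma compact_pointwise_bounded:
  fixes S :: "('i \<Rightarrow> real) set"
  assumes "closed S" and "\<And>\<phi> i. \<phi> \<in> S \<Longrightarrow> \<bar>\<phi> i\<bar> \<le> R i"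
  shows "compact S"
proof -
  have "compactin (product_topology (\<lambda>i. euclideanreal) UNIV) (PiE UNIV (\<lambda>i. cball 0 (R i)))"
    by (subst compactin_PiE) simp
  then have "compact (PiE UNIV (\<lambda>i. cball (0::real) (R i)))"
    by (simp add: euclidean_product_topology)
  moreover have "S = PiE UNIV (\<lambda>i. cball 0 (R i)) \<inter> S"
    using assms(2) by (auto simp: PiE_iff)
  ultimately show ?thesis
    using compact_Int_closed[OF _ assms(1)] by metis
qed

lemma Hausdorff_pointwise:
  "Hausdorff_space (euclidean :: ('i \<Rightarrow> real) topology)"
  by (subst euclidean_product_topology[symmetric])
     (simp add: Hausdorff_space_product_topology)

text \<open>
  The inequality \<open>\<bar>\<phi> x\<bar> \<le> norm (q x)\<close> does two things at once: it makes \<open>\<phi>\<close> vanish on the kernel of \<open>q\<close>, so that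
  \<open>\<phi>\<close> factors through \<open>q\<close>, and it bounds the factor by \<open>1\<close>.
\<close>

lemma quotient_ball_eq_pullback:
  fixes q :: "'x::real_vector \<Rightarrow> 'y::real_normed_vector"
  assumes q: "linear q" "surj q"
  shows "quotient_ball q = (\<lambda>(\<nu> :: 'y \<Rightarrow>\<^sub>L real) x. blinfun_apply \<nu> (q x)) ` cball 0 1"
proof (intro equalityI subsetI)
  fix \<phi>
  assume "\<phi> \<in> quotient_ball q"
  then have lin: "linear \<phi>" and le: "\<And>x. \<bar>\<phi> x\<bar> \<le> norm (q x)" by (auto simp: quotient_ball_def)
  obtain s where s: "\<And>g. q (s g) = g" using q(2) by (metis surj_def)
  have \<phi>: "\<phi> x = \<phi> y" if "q x = q y" for x y
    using le[of "x - y"] that by (simp add: linear_diff[OF lin] linear_diff[OF q(1)])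
  have bl: "bounded_linear (\<lambda>g. \<phi> (s g))"
  proof (rule bounded_linear_intro)
    fix g h c
    show "\<phi> (s (g + h)) = \<phi> (s g) + \<phi> (s h)"
      using \<phi>[of "s (g + h)" "s g + s h"] by (simp add: s linear_add[OF lin] linear_add[OF q(1)])
    show "\<phi> (s (c *\<^sub>R g)) = c *\<^sub>R \<phi> (s g)"
      using \<phi>[of "s (c *\<^sub>R g)" "c *\<^sub>R s g"] by (simp add: s linear_scale[OF lin] linear_scale[OF q(1)])
    show "norm (\<phi> (s g)) \<le> norm g * 1"
      using le[of "s g"] by (simp add: s)
  qed
  have "norm (Blinfun (\<lambda>g. \<phi> (s g))) \<le> 1"
  proof (rule norm_blinfun_bound)
    show "norm (blinfun_apply (Blinfun (\<lambda>g. \<phi> (s g))) g) \<le> 1 * norm g" for g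
      using le[of "s g"] by (simp add: s bounded_linear_Blinfun_apply[OF bl])
  qed simp
  moreover have "\<phi> = (\<lambda>x. blinfun_apply (Blinfun (\<lambda>g. \<phi> (s g))) (q x))"
    unfolding bounded_linear_Blinfun_apply[OF bl] by (rule ext, rule \<phi>) (simp add: s)
  ultimately show "\<phi> \<in> (\<lambda>(\<nu> :: 'y \<Rightarrow>\<^sub>L real) x. blinfun_apply \<nu> (q x)) ` cball 0 1" by auto
next
  fix \<phi>
  assume "\<phi> \<in> (\<lambda>(\<nu> :: 'y \<Rightarrow>\<^sub>L real) x. blinfun_apply \<nu> (q x)) ` cball 0 1"
  then obtain \<nu> where \<nu>: "norm \<nu> \<le> 1" "\<phi> = (\<lambda>x. blinfun_apply \<nu> (q x))" by auto
  have "\<bar>\<phi> x\<bar> \<le> norm (q x)" for x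
    using norm_blinfun[of \<nu> "q x"] mult_right_mono[OF \<nu>(1), of "norm (q x)"] by (simp add: \<nu>(2))
  moreover have "linear \<phi>"
    unfolding \<nu>(2)
    by (intro linearI) (simp_all add: linear_add[OF q(1)] linear_scale[OF q(1)] blinfun.add_right blinfun.scaleR_right)
  ultimately show "\<phi> \<in> quotient_ball q" by (simp add: quotient_ball_def)
qed

text \<open>
  The inverse of \<open>\<nu> \<mapsto> \<nu> \<circ> q\<close> is continuous because the value of \<open>\<nu>\<close> at \<open>g\<close> is the value of \<open>\<nu> \<circ> q\<close> at any
  preimage of \<open>g\<close>.
\<close>

lemma embedding_map_M1_pullback:
  fixes q :: "'x::real_vector \<Rightarrow> ('k::t2_space \<Rightarrow>\<^sub>C real)"
  assumes q: "linear q" "surj q" and S: "quotient_ball q \<subseteq> S"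
  shows "embedding_map M1 (top_of_set S) (\<lambda>\<nu> x. blinfun_apply \<nu> (q x))"
proof -
  let ?e = "\<lambda>(\<nu> :: 'k radon_measures) x. blinfun_apply \<nu> (q x)"
  have eS: "?e ` cball 0 1 \<subseteq> S"
    using S quotient_ball_eq_pullback[OF q] by blast
  obtain s where s: "\<And>g. q (s g) = g" using q(2) by (metis surj_def)
  define d where "d \<phi> = inv_into (cball 0 1) ?e \<phi>" for \<phi> :: "'x \<Rightarrow> real"
  have inj: "inj_on ?e (cball 0 1)"
  proof (rule inj_onI)
    fix \<nu> \<mu> :: "'k radon_measures"
    assume "?e \<nu> = ?e \<mu>"
    then have "blinfun_apply \<nu> (q (s g)) = blinfun_apply \<mu> (q (s g))" for g
      by (rule fun_cong)
    then show "\<nu> = \<mu>" by (intro blinfun_eqI) (simp add: s)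
  qed
  have de: "d (?e \<nu>) = \<nu>" if "\<nu> \<in> cball 0 1" for \<nu>
    using that inj unfolding d_def by (rule inv_into_f_f[rotated])
  have "continuous_map M1 euclidean ?e"
  proof -
    have "continuous_map M1 (product_topology (\<lambda>_. euclideanreal) UNIV) ?e"
      unfolding M1_def
      by (intro continuous_map_coordinatewise_then_product continuous_map_from_subtopology
          strong_operator_topology_continuous_evaluation) auto
    then show ?thesis by (simp add: euclidean_product_topology)
  qed
  then have ce: "continuous_map M1 (subtopology (top_of_set S) (?e ` cball 0 1)) ?e"
    using eS by (auto simp: continuous_map_in_subtopology subtopology_subtopology)
  have "continuous_map (top_of_set (?e ` cball 0 1)) strong_operator_topology d"
    unfolding continuous_on_strong_operator_topo_iff_coordinatewise
  proof
    fix g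
    have "continuous_map (top_of_set (?e ` cball 0 1)) euclidean (\<lambda>\<phi>. \<phi> (s g))"
      using continuous_on_subset[OF continuous_on_product_coordinates] by auto
    then show "continuous_map (top_of_set (?e ` cball 0 1)) euclidean (\<lambda>\<phi>. blinfun_apply (d \<phi>) g)"
      by (rule continuous_map_eq) (auto simp: de s)
  qed
  then have cd: "continuous_map (subtopology (top_of_set S) (?e ` cball 0 1)) M1 d"
    using eS de by (auto simp: M1_def continuous_map_in_subtopology subtopology_subtopology Int_absorb1)
  have "homeomorphic_maps M1 (subtopology (top_of_set S) (?e ` cball 0 1)) ?e d"
    unfolding homeomorphic_maps_def using ce cd de by auto
  then show ?thesis
    unfolding embedding_map_def homeomorphic_map_maps by auto
qed

section \<open>Biorthogonal functionals of a twisted sum\<close>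


text \<open>
  Let \<open>\<phi>\<close> be in the closure of the \<open>P n\<close>. If \<open>\<phi>\<close> vanishes on the range of \<open>j\<close>, then \<open>\<phi> x\<close> depends only on
  \<open>q x\<close>, and evaluating at a preimage of small norm gives \<open>\<bar>\<phi> x\<bar> \<le> b B norm (q x) \<le> norm (q x)\<close>. If
  \<open>\<phi> (j z) \<noteq> 0\<close>, then \<open>P n (j z) = a z n\<close> stays away from \<open>\<phi> (j z)\<close> for large \<open>n\<close>, so \<open>\<phi>\<close> is one of the
  finitely many remaining \<open>P n\<close>.
\<close>

lemma closed_Un_biorthogonal:
  fixes j :: "c0 \<Rightarrow> 'x::real_normed_vector" and q :: "'x \<Rightarrow> 'y::real_normed_vector"
  assumes q: "linear q" and ker: "range j = {x. q x = 0}"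
    and lift: "\<And>x. \<exists>x'. q x' = q x \<and> norm x' \<le> B * norm (q x)"
    and P: "\<And>n. linear (P n)" "\<And>n x. \<bar>P n x\<bar> \<le> b * norm x" "\<And>n z. P n (j z) = a * c0_nth z n"
    and b: "0 \<le> b" "b * B \<le> 1"
  shows "closed (quotient_ball q \<union> range P)"
proof -
  have "closure (range P) \<subseteq> quotient_ball q \<union> range P"
  proof
    fix \<phi> assume \<phi>: "\<phi> \<in> closure (range P)"
    have "closure (range P) \<subseteq> {\<phi>. linear \<phi> \<and> (\<forall>x. \<bar>\<phi> x\<bar> \<le> b * norm x)}"
      using P by (intro closure_minimal closed_dominated_functionals) auto
    with \<phi> have lin: "linear \<phi>" and le: "\<And>x. \<bar>\<phi> x\<bar> \<le> b * norm x" by auto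
    show "\<phi> \<in> quotient_ball q \<union> range P"
    proof (cases "\<forall>z. \<phi> (j z) = 0")
      case True
      have "\<bar>\<phi> x\<bar> \<le> norm (q x)" for x
      proof -
        obtain x' where x': "q x' = q x" "norm x' \<le> B * norm (q x)" using lift by blast
        then have "x - x' \<in> range j" by (simp add: ker linear_diff[OF q])
        then have "\<phi> x = \<phi> x'" using True linear_diff[OF lin, of x x'] by auto
        then have "\<bar>\<phi> x\<bar> \<le> b * (B * norm (q x))"
          using le[of x'] mult_left_mono[OF x'(2) b(1)] by simp
        also have "\<dots> \<le> norm (q x)"
          using mult_right_mono[OF b(2), of "norm (q x)"] by (simp add: mult.assoc)
        finally show ?thesis .
      qed
      then show ?thesis using lin by (simp add: quotient_ball_def)
    next
      case False
      then obtain z where z: "\<phi> (j z) \<noteq> 0" by blast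
      define \<epsilon> where "\<epsilon> = \<bar>\<phi> (j z)\<bar> / 2"
      have \<epsilon>: "0 < \<epsilon>" using z by (simp add: \<epsilon>_def)
      have "(\<lambda>n. a * c0_nth z n) \<longlonglongrightarrow> a * 0"
        by (intro tendsto_intros c0_nth_tendsto)
      then have "\<forall>\<^sub>F n in sequentially. \<bar>P n (j z)\<bar> < \<epsilon>"
        using \<epsilon> by (auto simp: tendsto_iff dist_real_def P(3))
      then obtain m where m: "\<And>n. m \<le> n \<Longrightarrow> \<bar>P n (j z)\<bar> < \<epsilon>"
        by (auto simp: eventually_sequentially)
      have "closed {P n}" for n
      proof -
        have "{P n} = (\<Inter>x. {\<psi>. \<psi> x = P n x})" by auto
        moreover have "closed \<dots>"
          by (intro closed_INT ballI closed_Collect_eq continuous_on_const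
              continuous_on_product_coordinates)
        ultimately show ?thesis by simp
      qed
      then have "closed (\<Union>n<m. {P n})" by (intro closed_UN) auto
      moreover have "closed {\<psi>. \<bar>\<psi> (j z)\<bar> \<le> \<epsilon>}"
        by (intro closed_Collect_le continuous_intros continuous_on_product_coordinates)
      ultimately have "closed ((\<Union>n<m. {P n}) \<union> {\<psi>. \<bar>\<psi> (j z)\<bar> \<le> \<epsilon>})" by (rule closed_Un)
      moreover have "range P \<subseteq> (\<Union>n<m. {P n}) \<union> {\<psi>. \<bar>\<psi> (j z)\<bar> \<le> \<epsilon>}"
        using m by (force simp: not_less intro: less_imp_le)
      ultimately have "\<phi> \<in> (\<Union>n<m. {P n}) \<union> {\<psi>. \<bar>\<psi> (j z)\<bar> \<le> \<epsilon>}"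
        using \<phi> closure_minimal by blast
      moreover have "\<not> \<bar>\<phi> (j z)\<bar> \<le> \<epsilon>" using \<epsilon> by (simp add: \<epsilon>_def)
      ultimately show ?thesis by auto
    qed
  qed
  then have "quotient_ball q \<union> range P = quotient_ball q \<union> closure (range P)"
    using closure_subset[of "range P"] by blast
  moreover have "closed (quotient_ball q)"
    unfolding quotient_ball_def by (rule closed_dominated_functionals)
  ultimately show ?thesis by (simp add: closed_Un)
qed

text \<open>
  All three claims follow by evaluation at the image under \<open>j\<close> of a unit vector of \<open>c\<^sub>0\<close>.
\<close>

lemma biorthogonal_isolated:
  fixes j :: "c0 \<Rightarrow> 'x::real_vector" and q :: "'x \<Rightarrow> 'y::real_normed_vector"
  assumes ker: "\<And>z. q (j z) = 0" and P: "\<And>n z. P n (j z) = a * c0_nth z n" and a: "0 < a"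
  shows "openin (top_of_set (quotient_ball q \<union> range P)) {P n}" and "P n \<notin> quotient_ball q"
    and "inj P"
proof -
  define u where "u n = j (c0_of (\<lambda>m. if m = n then 1 else 0))" for n
  have "\<forall>\<^sub>F m in sequentially. (if m = n then 1 else 0) = (0::real)" for n
    using eventually_gt_at_top[of n] by eventually_elim simp
  then have null: "(\<lambda>m. if m = n then 1 else 0::real) \<longlonglongrightarrow> 0" for n
    by (rule tendsto_eventually)
  have Pu: "P m (u n) = (if m = n then a else 0)" for m n
    by (simp add: u_def P null)
  show inj: "inj P"
  proof (rule injI)
    fix m n assume "P m = P n"
    then have "P m (u m) = P n (u m)" by simp
    then show "m = n" using a by (simp add: Pu split: if_splits)
  qed
  have qu: "\<phi> (u n) = 0" if "\<phi> \<in> quotient_ball q" for \<phi> n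
  proof -
    have "\<bar>\<phi> (u n)\<bar> \<le> norm (q (u n))" using that by (simp add: quotient_ball_def)
    then show ?thesis by (simp add: u_def ker)
  qed
  show "P n \<notin> quotient_ball q" for n
    using qu[of "P n" n] a by (auto simp: Pu)
  have "{P n} = (quotient_ball q \<union> range P) \<inter> {\<phi>. 0 < \<phi> (u n)}" (is "?l = ?r") for n
  proof
    show "?l \<subseteq> ?r" using a by (simp add: Pu)
    show "?r \<subseteq> ?l"
    proof
      fix \<phi> assume "\<phi> \<in> ?r"
      then obtain m where "\<phi> = P m" "0 < P m (u n)" using qu[of \<phi> n] by force
      then show "\<phi> \<in> ?l" by (simp add: Pu split: if_splits)
    qed
  qed
  moreover have "open {\<phi> :: 'x \<Rightarrow> real. 0 < \<phi> (u n)}" for n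
    by (intro open_Collect_less continuous_on_const continuous_on_product_coordinates)
  then have "openin (top_of_set (quotient_ball q \<union> range P))
      ((quotient_ball q \<union> range P) \<inter> {\<phi>. 0 < \<phi> (u n)})" for n
    by (rule openin_open_Int)
  ultimately show "openin (top_of_set (quotient_ball q \<union> range P)) {P n}" for n
    by simp
qed

section \<open>Correcting the functionals to a null sequence\<close>

text \<open>
  The points with \<open>\<bar>F x\<bar> < \<epsilon>\<close> form an open set containing \<open>A\<close>; with the open singletons \<open>{P n}\<close> it covers the
  compact set, and a finite subcover contains only finitely many of these.
\<close>

lemma tendsto_zero_along_isolated_points:
  fixes A :: "'a::topological_space set" and F :: "'a \<Rightarrow> real"
  assumes S: "compact (A \<union> range P)" and inj: "inj P"
    and iso: "\<And>n. openin (top_of_set (A \<union> range P)) {P n}"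
    and F: "continuous_on (A \<union> range P) F" "\<And>x. x \<in> A \<Longrightarrow> F x = 0"
  shows "(\<lambda>n. F (P n)) \<longlonglongrightarrow> 0"
proof (rule tendstoI)
  fix \<epsilon> :: real assume \<epsilon>: "0 < \<epsilon>"
  let ?S = "A \<union> range P"
  define W where "W = ?S \<inter> F -` ball 0 \<epsilon>"
  let ?C = "insert W (range (\<lambda>n. {P n}))"
  have "openin (top_of_set ?S) W"
    unfolding W_def using F(1) by (rule continuous_openin_preimage_gen) simp
  then have "\<forall>c\<in>?C. openin (top_of_set ?S) c"
    using iso by blast
  moreover have "?S \<subseteq> \<Union> ?C"
    using F(2) \<epsilon> by (auto simp: W_def)
  ultimately have "\<exists>D\<subseteq>?C. finite D \<and> ?S \<subseteq> \<Union> D"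
    using S unfolding compact_eq_openin_cover by (elim allE[of _ ?C]) (rule mp, blast+)
  then obtain D where D: "D \<subseteq> ?C" "finite D" "?S \<subseteq> \<Union> D"
    by blast
  have "finite (\<Union> (D - {W}))"
    using D(1,2) by (intro finite_Union) auto
  then have "finite (P -` \<Union> (D - {W}))"
    by (intro finite_vimageI inj)
  moreover have "{n. \<not> \<bar>F (P n)\<bar> < \<epsilon>} \<subseteq> P -` \<Union> (D - {W})"
  proof
    fix n assume n: "n \<in> {n. \<not> \<bar>F (P n)\<bar> < \<epsilon>}"
    then have "P n \<notin> W" by (simp add: W_def dist_real_def)
    moreover have "P n \<in> \<Union> D" using D(3) by blast
    ultimately show "n \<in> P -` \<Union> (D - {W})" by auto
  qed
  ultimately have "finite {n. \<not> \<bar>F (P n)\<bar> < \<epsilon>}" by (rule finite_subset[rotated])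
  then show "\<forall>\<^sub>F n in sequentially. dist (F (P n)) 0 < \<epsilon>"
    by (simp add: dist_real_def eventually_cofinite flip: cofinite_eq_sequentially)
qed

theorem theorem3p4:
  fixes j :: "c0 \<Rightarrow> 'x::banach" and q :: "'x \<Rightarrow> ('k::t2_space \<Rightarrow>\<^sub>C real)"
  assumes "compact (UNIV :: 'k set)"
    and "star_extension_property TYPE('k)"
    and "twisted_sum j q"
  shows "trivial_twisted_sum j q"
proof -
  have bl: "bounded_linear j" "bounded_linear q" and inj: "inj j"
    and ker: "range j = {x. q x = 0}" and surj: "surj q"
    using assms(3) by (auto simp: twisted_sum_def)
  then have lin: "linear j" "linear q"
    by (auto intro: bounded_linear.linear)
  have qj: "q (j z) = 0" for z using ker by blast
  have "closed (range j)"
    unfolding ker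
    by (intro closed_Collect_eq continuous_on_const linear_continuous_on bl)
  then obtain C where C: "0 < C" "\<And>y. y \<in> range j \<Longrightarrow> \<exists>z. j z = y \<and> norm z \<le> C * norm y"
    using closed_range_bounded_lift[OF bl(1)] by blast
  have C_le: "norm z \<le> C * norm (j z)" for z
    using C(2)[of "j z"] injD[OF inj] by blast
  have "closed (range q)" using surj by simp
  then obtain B where B: "0 < B" "\<And>y. \<exists>x. q x = y \<and> norm x \<le> B * norm y"
    using closed_range_bounded_lift[OF bl(2)] surj by (metis UNIV_I)
  have "sublinear (\<lambda>x :: 'x. C * norm x)"
    using C(1) by (intro sublinearI) (auto simp: norm_triangle_ineq simp flip: distrib_left)
  moreover have "c0_nth z n \<le> C * norm (j z)" for n z
    using abs_c0_nth_le[of z n] C_le[of z] by simp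
  ultimately have "\<exists>f. linear f \<and> (\<forall>x. f x \<le> C * norm x) \<and> (\<forall>z. f (j z) = c0_nth z n)" for n
    by (intro hahn_banach_along_linear_map lin linear_c0_nth)
  then obtain f where f_lin: "\<And>n. linear (f n)" and f_le: "\<And>n x. f n x \<le> C * norm x"
    and f_j: "\<And>n z. f n (j z) = c0_nth z n"
    by metis
  have f_abs: "\<bar>f n x\<bar> \<le> C * norm x" for n x
    using f_le[of n x] f_le[of n "- x"] by (simp add: linear_neg[OF f_lin])
  \<comment> \<open>With this factor the cluster points of \<open>a f n\<close> are measures of norm at most \<open>1\<close> composed with \<open>q\<close>.\<close>
  define a where "a = inverse (C * B)"
  have a: "0 < a" "a * C * B = 1" using C(1) B(1) by (auto simp: a_def field_simps)
  define P where "P n x = a * f n x" for n x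
  have P_lin: "linear (P n)" for n
    unfolding P_def by (rule linearI)
      (simp_all add: linear_add[OF f_lin] linear_scale[OF f_lin] algebra_simps)
  have P_abs: "\<bar>P n x\<bar> \<le> a * C * norm x" for n x
    using mult_left_mono[OF f_abs[of n x], of a] a(1) by (simp add: P_def abs_mult mult.assoc)
  have P_j: "P n (j z) = a * c0_nth z n" for n z
    by (simp add: P_def f_j)
  define S where "S = quotient_ball q \<union> range P"
  have closed: "closed S"
    unfolding S_def
    by (rule closed_Un_biorthogonal[OF lin(2) ker _ P_lin P_abs P_j]) (use B a C in auto)
  have compact: "compact S"
  proof (rule compact_pointwise_bounded[OF closed])
    show "\<bar>\<phi> x\<bar> \<le> max (norm (q x)) (a * C * norm x)" if "\<phi> \<in> S" for \<phi> x
      using that P_abs by (auto simp: S_def quotient_ball_def le_max_iff_disj)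
  qed
  note isolated = biorthogonal_isolated[where j = j and q = q and P = P and a = a, OF qj P_j a(1), folded S_def]
  let ?e = "\<lambda>(\<nu> :: 'k radon_measures) x. blinfun_apply \<nu> (q x)"
  have e_img: "?e ` cball 0 1 = quotient_ball q"
    using quotient_ball_eq_pullback[OF lin(2) surj] by simp
  have diff: "S - quotient_ball q = range P"
    using isolated(2) by (auto simp: S_def)
  have "countable_discrete_extension M1 (top_of_set S) ?e"
    unfolding countable_discrete_extension_def topspace_M1 e_img topspace_euclidean_subtopology diff
  proof (intro conjI)
    show "compact_space (top_of_set S)"
      using compact by (intro compact_space_subtopology) (simp only: compactin_euclidean_iff)
    show "Hausdorff_space (top_of_set S)"
      by (intro Hausdorff_space_subtopology Hausdorff_pointwise)
    show "embedding_map M1 (top_of_set S) ?e"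
      by (intro embedding_map_M1_pullback lin surj) (simp add: S_def)
    show "subtopology (top_of_set S) (range P) = discrete_topology (range P)"
    proof -
      have "openin (subtopology (top_of_set S) (range P)) {P n}" for n
        by (rule openin_subtopology_Int2[OF isolated(1)[of n], of "range P", simplified])
      then show ?thesis
        by (subst eq_commute, subst discrete_topology_unique_alt) (auto simp: S_def)
    qed
  qed simp
  then obtain E where E: "bounded_linear_to_C (top_of_set S) E"
    and Ee: "\<And>g \<nu>. \<nu> \<in> cball 0 1 \<Longrightarrow> E g (?e \<nu>) = blinfun_apply \<nu> g"
    using star_extension_property_arbitrary_type[OF assms(2)] by blast
  have PS: "P n \<in> S" for n by (simp add: S_def)
  obtain D where "\<And>g \<phi>. \<phi> \<in> S \<Longrightarrow> \<bar>E g \<phi>\<bar> \<le> D * norm g"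
    using E unfolding bounded_linear_to_C_def topspace_euclidean_subtopology by blast
  then have D: "\<bar>E g \<phi>\<bar> \<le> \<bar>D\<bar> * norm g" if "\<phi> \<in> S" for g \<phi>
    using that mult_right_mono[OF abs_ge_self[of D] norm_ge_zero[of g]] by (meson order_trans)
  have E_add: "E (g + h) \<phi> = E g \<phi> + E h \<phi>" and E_scale: "E (c *\<^sub>R g) \<phi> = c * E g \<phi>"
    and E_cont: "continuous_on S (E g)" if "\<phi> \<in> S" for g h c \<phi>
    using E that by (auto simp: bounded_linear_to_C_def)
  \<comment> \<open>\<open>G n\<close> is \<open>f n\<close> corrected by the functional \<open>g \<mapsto> E g (P n) / a\<close> composed with \<open>q\<close>.\<close>
  define G where "G n x = inverse a * (P n x - E (q x) (P n))" for n x
  have G_lin: "linear (G n)" for n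
    unfolding G_def
    by (rule linearI) (simp_all add: linear_add[OF P_lin] linear_scale[OF P_lin] linear_add[OF lin(2)]
        linear_scale[OF lin(2)] E_add[OF PS] E_scale[OF PS] algebra_simps)
  have G_null: "(\<lambda>n. G n x) \<longlonglongrightarrow> 0" for x
  proof -
    have "(\<lambda>n. P n x - E (q x) (P n)) \<longlonglongrightarrow> 0"
    proof (rule tendsto_zero_along_isolated_points[where F = "\<lambda>\<phi>. \<phi> x - E (q x) \<phi>" and A = "quotient_ball q" and P = P,
          folded S_def, OF compact isolated(3,1)])
      show "continuous_on S (\<lambda>\<phi>. \<phi> x - E (q x) \<phi>)"
        using PS by (intro continuous_on_diff E_cont continuous_on_subset[OF continuous_on_product_coordinates]) auto
      fix \<phi> assume "\<phi> \<in> quotient_ball q"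
      then obtain \<nu> where "\<nu> \<in> cball 0 1" "\<phi> = ?e \<nu>" using e_img by blast
      then show "\<phi> x - E (q x) \<phi> = 0" using Ee by simp
    qed
    then have "(\<lambda>n. inverse a * (P n x - E (q x) (P n))) \<longlonglongrightarrow> inverse a * 0"
      by (rule tendsto_mult_left)
    then show ?thesis by (simp add: G_def)
  qed
  obtain Q where Q: "0 \<le> Q" "\<And>x. norm (q x) \<le> norm x * Q"
    using bounded_linear.nonneg_bounded[OF bl(2)] by blast
  have G_abs: "\<bar>G n x\<bar> \<le> inverse a * (a * C + \<bar>D\<bar> * Q) * norm x" for n x
  proof -
    have "\<bar>E (q x) (P n)\<bar> \<le> \<bar>D\<bar> * (norm x * Q)"
      using D[OF PS, of "q x" n] mult_left_mono[OF Q(2)[of x] abs_ge_zero[of D]] by linarith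
    then have "\<bar>P n x - E (q x) (P n)\<bar> \<le> a * C * norm x + \<bar>D\<bar> * (norm x * Q)"
      using P_abs[of n x] by linarith
    then have "inverse a * \<bar>P n x - E (q x) (P n)\<bar> \<le> inverse a * (a * C * norm x + \<bar>D\<bar> * (norm x * Q))"
      using a(1) by (intro mult_left_mono) auto
    moreover have "\<bar>G n x\<bar> = inverse a * \<bar>P n x - E (q x) (P n)\<bar>"
      using a(1) by (simp only: G_def abs_mult) simp
    ultimately show ?thesis
      by (simp only: algebra_simps)
  qed
  have "c0_of (\<lambda>n. G n (j z)) = z" for z
  proof (rule c0_nth_eqI)
    fix n
    have "E (q (j z)) (P n) = 0" using E_scale[OF PS, of 0 0] by (simp add: qj)
    then show "c0_nth (c0_of (\<lambda>n. G n (j z))) n = c0_nth z n"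
      using a(1) by (simp only: c0_nth_of[OF G_null]) (simp add: G_def P_j)
  qed
  moreover have "bounded_linear (\<lambda>x. c0_of (\<lambda>n. G n x))"
    by (rule bounded_linear_c0_of[OF G_lin G_abs G_null])
  ultimately show ?thesis
    using assms(3) unfolding trivial_twisted_sum_def
    by (intro conjI exI[of _ "\<lambda>x. c0_of (\<lambda>n. G n x)"]) auto
qed

end
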